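(* Let $S\in\mathbb{N}$ and, for $s=1,\dots,S$, let $Z_s$ be non-negative random variables (on a common probability space) that satisfy, for certain positive constants $H_1,\dots,H_S$ and for all $a>0$, $$\mathbb{P}\big(Z_s\ge\sqrt{H_s+a}\big)\le\exp[-a],\qquad s=1,\dots,S .$$ Then $$\mathbb{E}\max_{1\le s\le S}\Big[Z_s-\sqrt{H_s+s\log2}\Big]_+^2\le1 .$$
   Context: $[x]_+:=\max(x,0)$ denotes the positive part of $x\in\mathbb{R}$, and $[x]_+^2=([x]_+)^2$. *)

theory Defs
  imports "HOL-Probability.Probability"
begin

end

theory Submission imports Defs begin

text \<open>With \<open>c = sqrt (H s + s * ln 2)\<close>, superadditivity of the square gives
  \<open>(c + sqrt t)\<^sup>2 \<ge> H s + (s * ln 2 + t)\<close>, so the squared excess of \<open>Z s\<close> over \<open>c\<close> has tail at most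
  \<open>2 powr - s * exp (- t)\<close>. Integrating the tail bounds its expectation by \<open>(1/2) ^ s\<close>; bound the
  maximum by the sum and sum the geometric series.\<close>

text \<open>Layer-cake formula: \<open>ennreal (X \<omega>)\<close> is the length of
  \<open>{0<..X \<omega>}\<close>, both being 0 when \<open>X \<omega>\<close> is negative, and
  Tonelli swaps the two integrals.\<close>

lemma (in sigma_finite_measure) nn_integral_eq_integral_tail:
  fixes X :: "'a \<Rightarrow> real"
  assumes [measurable]: "X \<in> borel_measurable M"
  shows "(\<integral>\<^sup>+\<omega>. ennreal (X \<omega>) \<partial>M)
    = (\<integral>\<^sup>+t. emeasure M {\<omega> \<in> space M. t \<le> X \<omega>} * indicator {0<..} t \<partial>lborel)"
proof -
  interpret pair_sigma_finite M lborel ..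
  have "(\<integral>\<^sup>+\<omega>. ennreal (X \<omega>) \<partial>M)
      = (\<integral>\<^sup>+\<omega>. (\<integral>\<^sup>+t. indicator {t. 0 < t \<and> t \<le> X \<omega>} t \<partial>lborel) \<partial>M)"
  proof (rule nn_integral_cong)
    fix \<omega>
    have "{t. 0 < t \<and> t \<le> X \<omega>} = {0<..X \<omega>}" by auto
    then show "ennreal (X \<omega>) = (\<integral>\<^sup>+t. indicator {t. 0 < t \<and> t \<le> X \<omega>} t \<partial>lborel)"
      by (cases "0 \<le> X \<omega>") (simp_all add: ennreal_neg)
  qed
  also have "\<dots> = (\<integral>\<^sup>+t. (\<integral>\<^sup>+\<omega>. indicator {t. 0 < t \<and> t \<le> X \<omega>} t \<partial>M) \<partial>lborel)"
    by (rule Fubini'[symmetric]) measurable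
  also have "\<dots> = (\<integral>\<^sup>+t. emeasure M {\<omega> \<in> space M. t \<le> X \<omega>} * indicator {0<..} t \<partial>lborel)"
  proof (rule nn_integral_cong)
    fix t :: real
    have "(\<integral>\<^sup>+\<omega>. indicator {t. 0 < t \<and> t \<le> X \<omega>} t \<partial>M)
        = (\<integral>\<^sup>+\<omega>. indicator {0<..} t * indicator {\<omega> \<in> space M. t \<le> X \<omega>} \<omega> \<partial>M)"
      by (rule nn_integral_cong) (auto split: split_indicator)
    then show "(\<integral>\<^sup>+\<omega>. indicator {t. 0 < t \<and> t \<le> X \<omega>} t \<partial>M)
        = emeasure M {\<omega> \<in> space M. t \<le> X \<omega>} * indicator {0<..} t"
      by (simp add: nn_integral_cmult mult.commute)
  qed
  finally show ?thesis .
qed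

text \<open>By the layer-cake formula, since \<open>exp (- t)\<close> has integral 1 over the
  positive half-line. The tail is bounded only for \<open>0 < t\<close>: a squared positive part has
  tail 1 at \<open>t = 0\<close>, which would exceed \<open>C\<close> when
  \<open>C < 1\<close>.\<close>

lemma (in prob_space) nn_integral_le_of_exp_tail:
  fixes X :: "'a \<Rightarrow> real"
  assumes X: "X \<in> borel_measurable M" and "0 \<le> C"
    and tail: "\<And>t. 0 < t \<Longrightarrow> prob {\<omega> \<in> space M. t \<le> X \<omega>} \<le> C * exp (- t)"
  shows "(\<integral>\<^sup>+\<omega>. ennreal (X \<omega>) \<partial>M) \<le> ennreal C"
proof -
  have "(\<integral>\<^sup>+\<omega>. ennreal (X \<omega>) \<partial>M)
      = (\<integral>\<^sup>+t. emeasure M {\<omega> \<in> space M. t \<le> X \<omega>} * indicator {0<..} t \<partial>lborel)"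
    by (rule nn_integral_eq_integral_tail[OF X])
  \<comment> \<open>The factor \<open>t ^ 0\<close> and the closed half-line give the integrand the
    shape of the Gamma integral, whose value here is \<open>fact 0 = 1\<close>.\<close>
  also have "\<dots> \<le> (\<integral>\<^sup>+t. ennreal C * (ennreal (t ^ 0 * exp (- t)) * indicator {0..} t) \<partial>lborel)"
    using tail \<open>0 \<le> C\<close>
    by (intro nn_integral_mono)
       (auto simp: emeasure_eq_measure ennreal_mult[symmetric] intro!: ennreal_leI split: split_indicator)
  also have "\<dots> = ennreal C"
    by (subst nn_integral_cmult) (simp_all add: nn_intergal_power_times_exp_Ici del: power_0)
  finally show ?thesis .
qed

theorem lemma3p4p1:
  fixes M :: "'a measure" and S :: nat
    and Z :: "nat \<Rightarrow> 'a \<Rightarrow> real" and H :: "nat \<Rightarrow> real"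
  assumes "prob_space M"
    and "1 \<le> S"
    and "\<And>s. s \<in> {1..S} \<Longrightarrow> Z s \<in> borel_measurable M"
    and "\<And>s \<omega>. s \<in> {1..S} \<Longrightarrow> \<omega> \<in> space M \<Longrightarrow> 0 \<le> Z s \<omega>"
    and "\<And>s. s \<in> {1..S} \<Longrightarrow> 0 < H s"
    and "\<And>s a. s \<in> {1..S} \<Longrightarrow> 0 < a \<Longrightarrow>
           \<P>(\<omega> in M. Z s \<omega> \<ge> sqrt (H s + a)) \<le> exp (- a)"
  shows "integrable M (\<lambda>\<omega>. MAX s\<in>{1..S}. (max (Z s \<omega> - sqrt (H s + real s * ln 2)) 0)\<^sup>2)
    \<and> (\<integral>\<omega>. (MAX s\<in>{1..S}. (max (Z s \<omega> - sqrt (H s + real s * ln 2)) 0)\<^sup>2) \<partial>M) \<le> 1"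
proof -
  interpret prob_space M by fact
  define X where "X s \<omega> = (max (Z s \<omega> - sqrt (H s + real s * ln 2)) 0)\<^sup>2" for s \<omega>
  define Y where "Y \<omega> = (MAX s\<in>{1..S}. X s \<omega>)" for \<omega>
  have X_meas: "X s \<in> borel_measurable M" if "s \<in> {1..S}" for s
  proof -
    note [measurable] = assms(3)[OF that]
    show ?thesis unfolding X_def by measurable
  qed
  have X_nonneg: "0 \<le> X s \<omega>" for s \<omega> by (simp add: X_def)
  have X_int: "(\<integral>\<^sup>+\<omega>. ennreal (X s \<omega>) \<partial>M) \<le> ennreal ((1/2) ^ s)" if s: "s \<in> {1..S}" for s
  proof (rule nn_integral_le_of_exp_tail[OF X_meas[OF s]])
    fix t :: real assume t: "0 < t"
    define c where "c = sqrt (H s + real s * ln 2)"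
    have Hs: "0 < H s" using assms(5)[OF s] .
    have "sqrt (H s + (real s * ln 2 + t)) \<le> Z s \<omega>" if "t \<le> X s \<omega>" for \<omega>
    proof -
      have "sqrt t \<le> max (Z s \<omega> - c) 0"
        using that by (simp add: X_def c_def real_le_lsqrt)
      \<comment> \<open>As \<open>sqrt t\<close> is strictly positive, the maximum cannot be its 0
        branch.\<close>
      then have "c + sqrt t \<le> Z s \<omega>" using t by (auto simp: max_def not_le split: if_splits)
      moreover have "sqrt (H s + (real s * ln 2 + t)) \<le> c + sqrt t"
        using sqrt_add_le_add_sqrt[of "H s + real s * ln 2" t] Hs t by (simp add: c_def add.assoc)
      ultimately show ?thesis by linarith
    qed
    moreover note [measurable] = assms(3)[OF s]
    ultimately have "prob {\<omega> \<in> space M. t \<le> X s \<omega>}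
        \<le> \<P>(\<omega> in M. Z s \<omega> \<ge> sqrt (H s + (real s * ln 2 + t)))"
      by (intro finite_measure_mono) auto
    \<comment> \<open>The tail hypothesis with \<open>a = real s * ln 2 + t\<close>; the first
      summand yields the factor \<open>(1/2) ^ s\<close>.\<close>
    also have "\<dots> \<le> exp (- (real s * ln 2 + t))"
      using t by (intro assms(6)[OF s]) (simp add: add_nonneg_pos)
    also have "\<dots> = (1/2) ^ s * exp (- t)"
      by (simp add: exp_add exp_diff exp_minus exp_of_nat_mult power_divide field_simps)
    finally show "prob {\<omega> \<in> space M. t \<le> X s \<omega>} \<le> (1/2) ^ s * exp (- t)" .
  qed simp
  \<comment> \<open>The sum starts at \<open>s = 1\<close>, so it stays below 1; a term for
    \<open>s = 0\<close> would push it towards 2.\<close>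
  have geom: "(\<Sum>s\<in>{1..S}. (1/2::real) ^ s) = 1 - (1/2) ^ S"
    by (induction S) auto
  \<comment> \<open>A maximum of nonnegative terms is at most their sum; \<open>1 \<le> S\<close>
    makes the index set nonempty, so \<open>Max\<close> is a genuine maximum.\<close>
  have Y_le: "Y \<omega> \<le> (\<Sum>s\<in>{1..S}. X s \<omega>)" for \<omega>
    unfolding Y_def using \<open>1 \<le> S\<close>
    by (subst Max_le_iff) (auto intro!: member_le_sum X_nonneg)
  have Y_nonneg: "0 \<le> Y \<omega>" for \<omega>
    unfolding Y_def using \<open>1 \<le> S\<close> X_nonneg by (subst Max_ge_iff) auto
  have Y_meas: "Y \<in> borel_measurable M"
    unfolding Y_def by (intro borel_measurable_Max X_meas) auto
  have "(\<integral>\<^sup>+\<omega>. ennreal (Y \<omega>) \<partial>M) \<le> (\<integral>\<^sup>+\<omega>. (\<Sum>s\<in>{1..S}. ennreal (X s \<omega>)) \<partial>M)"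
    using Y_le by (intro nn_integral_mono) (simp add: sum_ennreal X_nonneg ennreal_leI)
  also have "\<dots> = (\<Sum>s\<in>{1..S}. \<integral>\<^sup>+\<omega>. ennreal (X s \<omega>) \<partial>M)"
    by (rule nn_integral_sum) (use X_meas in simp)
  also have "\<dots> \<le> (\<Sum>s\<in>{1..S}. ennreal ((1/2) ^ s))"
    by (intro sum_mono X_int)
  also have "\<dots> = ennreal (1 - (1/2) ^ S)"
    by (simp only: sum_ennreal geom[symmetric] zero_le_power zero_le_divide_1_iff zero_le_numeral)
  also have "\<dots> \<le> ennreal 1" by (intro ennreal_leI) simp
  finally have Y_int: "(\<integral>\<^sup>+\<omega>. ennreal (Y \<omega>) \<partial>M) \<le> ennreal 1" .
  \<comment> \<open>Finiteness of the nonnegative integral gives integrability. This makes the final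
    bound meaningful, since the Bochner integral of a non-integrable function is 0 by
    default.\<close>
  have "integrable M Y"
    using Y_int Y_meas Y_nonneg
    by (intro integrableI_nonneg) (auto intro: le_less_trans)
  moreover have "(\<integral>\<omega>. Y \<omega> \<partial>M) \<le> 1"
    using Y_int Y_nonneg nn_integral_eq_integral[OF \<open>integrable M Y\<close>] by simp
  ultimately show ?thesis by (simp add: Y_def[abs_def] X_def)
qed

end
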